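(* For every $r\ge 3$ and $t\ge 2$, \[ \gamma_{r-1}^+(\mathcal D_{r,t+1})\le 1-\frac1t-\frac{1}{36t^2}. \]
   Context: An $r$-graph is a collection of $r$-element subsets (edges) of a finite vertex set. For an $r$-graph $\mathcal H$ and an $(r-1)$-set $S$ of vertices, $d_{\mathcal H}(S)$ is the number of edges containing $S$. For a nonempty $r$-graph $\mathcal H$, the positive $(r-1)$-codegree is $\delta_{r-1}^+(\mathcal H)=\min\{d_{\mathcal H}(S): S\in\binom{V(\mathcal H)}{r-1},\ d_{\mathcal H}(S)>0\}$. For an $r$-graph $F$, $\operatorname{co\text{-}ex}_{r-1}^+(n,F)$ is the maximum of $\delta_{r-1}^+(\mathcal H)$ over all $F$-free (containing no copy of $F$ as a subgraph) $r$-graphs $\mathcal H$ on $n$ vertices, and $\gamma_{r-1}^+(F)=\lim_{n\to\infty}\operatorname{co\text{-}ex}_{r-1}^+(n,F)/n$ (this limit exists). The $(r,t)$-daisy $\mathcal D_{r,t}$ is the $r$-graph obtained from the complete graph $K_t$ by adding a fixed set of $r-2$ new vertices to each of its edges. *)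

theory Defs
  imports Complex_Main "HOL-Library.Ramsey"
begin

type_synonym 'a hypergraph = "'a set \<times> 'a set set"

abbreviation verts :: "'a hypergraph \<Rightarrow> 'a set" where "verts \<equiv> fst"
abbreviation edges :: "'a hypergraph \<Rightarrow> 'a set set" where "edges \<equiv> snd"

definition r_graph :: "nat \<Rightarrow> 'a hypergraph \<Rightarrow> bool" where
  "r_graph r H \<longleftrightarrow> finite (verts H) \<and> edges H \<subseteq> nsets (verts H) r"

definition set_degree :: "'a hypergraph \<Rightarrow> 'a set \<Rightarrow> nat" where
  "set_degree H S = card {e \<in> edges H. S \<subseteq> e}"

text \<open>Meaningful for \<open>r\<close>-graphs with at least one edge and \<open>r \<ge> 1\<close>; otherwise the minimum is
  taken over the empty set.\<close>

definition pos_codegree :: "nat \<Rightarrow> 'a hypergraph \<Rightarrow> nat" where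
  "pos_codegree r H =
     Min {set_degree H S | S. S \<in> nsets (verts H) (r - 1) \<and> set_degree H S > 0}"

definition contains_copy :: "'a hypergraph \<Rightarrow> 'b hypergraph \<Rightarrow> bool" where
  "contains_copy H F \<longleftrightarrow>
     (\<exists>f. inj_on f (verts F) \<and> f ` verts F \<subseteq> verts H \<and> (\<forall>e\<in>edges F. f ` e \<in> edges H))"

text \<open>Vertices are natural numbers without loss of generality. For fixed \<open>F\<close> with at least two
  edges and \<open>r \<ge> 1\<close>, the maximum is over a nonempty set as soon as \<open>n \<ge> r\<close>, since a single
  edge on \<open>n\<close> vertices is \<open>F\<close>-free.\<close>

definition co_ex_pos :: "nat \<Rightarrow> nat \<Rightarrow> 'b hypergraph \<Rightarrow> nat" where
  "co_ex_pos r n F =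
     Max {pos_codegree r H | H :: nat hypergraph.
            r_graph r H \<and> card (verts H) = n \<and> edges H \<noteq> {} \<and> \<not> contains_copy H F}"

definition pos_codegree_density :: "nat \<Rightarrow> 'b hypergraph \<Rightarrow> real" where
  "pos_codegree_density r F = lim (\<lambda>n. real (co_ex_pos r n F) / real n)"

text \<open>The complete graph lives on \<open>{..<t}\<close>; the \<open>r - 2\<close> new vertices are \<open>{t..<t + (r - 2)}\<close>.\<close>

definition daisy :: "nat \<Rightarrow> nat \<Rightarrow> nat hypergraph" where
  "daisy r t =
     ({..<t + (r - 2)}, {e \<union> {t..<t + (r - 2)} | e. e \<in> nsets {..<t} 2})"

end

theory Submission imports Defs "HOL-Analysis.Convex" begin

text \<open>Any two vertices of a daisy lie in a common edge, so blow-ups of daisy-free graphs are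
  daisy-free; hence the density is a limit that equals the supremum of \<open>co-ex / n\<close>, and it
  suffices to bound the positive codegree \<open>\<delta>\<close> of every single daisy-free graph. Passing to the link
  of an \<open>(r - 3)\<close>-set reduces this to \<open>r = 3\<close>.

  For a pair \<open>v x\<close> of positive codegree let \<open>W(v, x)\<close> be the set of the at most
  \<open>D = n - \<delta>\<close> vertices \<open>z\<close> for which \<open>vxz\<close> is not an edge. The link graph of \<open>v\<close> has no
  \<open>K\<^sub>t\<^sub>+\<^sub>1\<close>, and every vertex \<open>x\<close> of it lies in a \<open>t\<close>-clique \<open>C\<close>. The sets \<open>W(v, c)\<close>, \<open>c \<in> C\<close>, cover all
  vertices, so at most \<open>K = tD - n\<close> points are covered twice, and off these points they are
  independent classes of the link. If \<open>\<delta>\<close> is close to \<open>(1 - 1/t) n\<close>, then \<open>K\<close> is small, and so for a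
  typical edge \<open>vxz\<close> the sets \<open>W(v, z)\<close> and \<open>W(x, z)\<close> are almost disjoint. On the other hand, for fixed
  \<open>v, x\<close> the classes of the links of \<open>v\<close> and of \<open>x\<close> cut almost all the vertices outside
  \<open>W(v, x)\<close> into \<open>(t - 1)\<^sup>2\<close> cells, and \<open>W(v, z) \<inter> W(x, z)\<close> contains the cell of \<open>z\<close>, which
  on average has about \<open>n / t\<^sup>2\<close> elements.\<close>

section \<open>Graphs of high degree without a clique on \<open>t + 1\<close> vertices\<close>

text \<open>Such a graph will be the link of a vertex. A positive codegree controls only pairs lying
  in an edge, so \<open>D\<close> bounds the non-neighbours of non-isolated vertices only.\<close>

locale dense_clique_free_graph =
  fixes V :: "'a set" and R :: "'a \<Rightarrow> 'a \<Rightarrow> bool" and t D :: nat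
  assumes finite_V: "finite V"
    and R_in_V: "R x y \<Longrightarrow> x \<in> V"
    and R_sym: "R x y \<Longrightarrow> R y x"
    and R_irrefl: "\<not> R x x"
    and t_ge_2: "t \<ge> 2"
    and small_D: "(t - 1) * D < card V"
    and codegree: "R x y \<Longrightarrow> card {z \<in> V. \<not> R x z} \<le> D"
    and clique_free: "\<lbrakk>C \<subseteq> V; card C = Suc t\<rbrakk> \<Longrightarrow> \<exists>x\<in>C. \<exists>y\<in>C. x \<noteq> y \<and> \<not> R x y"
begin

definition nonnbrs :: "'a \<Rightarrow> 'a set" where
  "nonnbrs x = {z \<in> V. \<not> R x z}"

definition clique :: "'a set \<Rightarrow> bool" where
  "clique C \<longleftrightarrow> C \<subseteq> V \<and> (\<forall>x\<in>C. \<forall>y\<in>C. x \<noteq> y \<longrightarrow> R x y)"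

definition isolated :: "'a set" where
  "isolated = {p \<in> V. \<forall>y. \<not> R p y}"

definition overlap :: "'a set \<Rightarrow> 'a set" where
  "overlap C = {p \<in> V. \<exists>x\<in>C. \<exists>y\<in>C. x \<noteq> y \<and> p \<in> nonnbrs x \<and> p \<in> nonnbrs y}"

text \<open>The truncated subtraction loses nothing once \<open>R\<close> has an edge: the
  \<open>t\<close> sets \<open>nonnbrs c\<close> of a maximum clique then cover \<open>V\<close>, so
  \<open>card V <= t * D\<close>.\<close>

definition excess :: nat where
  "excess = t * D - card V"

lemma finite_nonnbrs [simp]: "finite (nonnbrs x)"
  using finite_V by (simp add: nonnbrs_def)

lemma card_nonnbrs: "R x y \<Longrightarrow> card (nonnbrs x) \<le> D"
  using codegree by (simp add: nonnbrs_def)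

lemma finite_clique: "clique C \<Longrightarrow> finite C"
  using finite_V by (auto simp: clique_def intro: finite_subset)

text \<open>Greedy extension: fewer than \<open>t\<close> non-isolated vertices have at most
  \<open>(t - 1) * D < card V\<close> non-neighbours in all, which leaves a common neighbour.
  Non-isolation of the members is carried along because \<open>card_nonnbrs\<close> requires
  it.\<close>

lemma exists_clique:
  assumes "R x y" "k < t"
  shows "\<exists>C. clique C \<and> card C = Suc k \<and> x \<in> C \<and> (\<forall>c\<in>C. \<exists>d. R c d)"
  using assms(2)
proof (induction k)
  case 0
  then show ?case
    using assms R_in_V by (intro exI[of _ "{x}"]) (auto simp: clique_def)
next
  case (Suc k)
  then obtain C where C: "clique C" "card C = Suc k" "x \<in> C" "\<forall>c\<in>C. \<exists>d. R c d"
    by auto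
  have finC: "finite C"
    by (rule finite_clique) fact
  have "card (\<Union>(nonnbrs ` C)) \<le> (\<Sum>c\<in>C. card (nonnbrs c))"
    using finC by (rule card_UN_le)
  also have "\<dots> \<le> card C * D"
    using C(4) card_nonnbrs by (intro sum_bounded_above[where 'a=nat, simplified]) auto
  also have "\<dots> \<le> (t - 1) * D"
    using C(2) Suc.prems by (intro mult_right_mono) auto
  also have "\<dots> < card V"
    by (rule small_D)
  finally have "\<not> V \<subseteq> \<Union>(nonnbrs ` C)"
    using finC by (meson card_mono finite_UN finite_nonnbrs not_le)
  then obtain z where z: "z \<in> V" "\<forall>c\<in>C. R c z"
    by (auto simp: nonnbrs_def)
  have zC: "z \<notin> C"
    using z R_irrefl by auto
  show ?case
  proof (intro exI[of _ "insert z C"] conjI)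
    show "clique (insert z C)"
      using C(1) z R_sym by (auto simp: clique_def)
    show "card (insert z C) = Suc (Suc k)"
      using C(2) finC zC by simp
    show "\<forall>c\<in>insert z C. \<exists>d. R c d"
      using C z R_sym by blast
  qed (use C in auto)
qed

lemma exists_max_clique:
  assumes "R x y"
  shows "\<exists>C. clique C \<and> card C = t \<and> x \<in> C \<and> (\<forall>c\<in>C. \<exists>d. R c d)"
  using exists_clique[OF assms, of "t - 1"] t_ge_2 by auto

lemma clique_card_ne: "clique C \<Longrightarrow> card C \<noteq> Suc t"
  using clique_free unfolding clique_def by blast

text \<open>An uncovered vertex would extend the clique to \<open>t + 1\<close> vertices.\<close>

lemma max_clique_covers:
  assumes "clique C" "card C = t" "p \<in> V"
  shows "\<exists>c\<in>C. p \<in> nonnbrs c"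
proof (rule ccontr)
  assume "\<not> ?thesis"
  then have p: "\<forall>c\<in>C. R c p"
    using assms(3) by (auto simp: nonnbrs_def)
  then have "p \<notin> C"
    using R_irrefl by auto
  moreover have "finite C"
    by (rule finite_clique) fact
  ultimately have "card (insert p C) = Suc t"
    using assms by simp
  moreover have "clique (insert p C)"
    using p assms R_sym by (auto simp: clique_def)
  ultimately show False
    using clique_card_ne by blast
qed

lemma sum_multiplicity_le:
  assumes C: "clique C" "card C = t" "\<forall>c\<in>C. \<exists>d. R c d"
  shows "(\<Sum>p\<in>V. card {c \<in> C. p \<in> nonnbrs c}) \<le> t * D"
proof -
  have finC: "finite C"
    by (rule finite_clique) fact
  have "(\<Sum>p\<in>V. card {c \<in> C. p \<in> nonnbrs c}) = (\<Sum>c\<in>C. card {p \<in> V. p \<in> nonnbrs c})"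
    by (rule sum_multicount_gen) (use finite_V finC in auto)
  also have "\<dots> \<le> card C * D"
  proof (intro sum_bounded_above[where 'a=nat, simplified])
    fix c assume "c \<in> C"
    then obtain d where "R c d" using C by auto
    moreover have "{p \<in> V. p \<in> nonnbrs c} = nonnbrs c"
      by (auto simp: nonnbrs_def)
    ultimately show "card {p \<in> V. p \<in> nonnbrs c} \<le> D"
      using card_nonnbrs by simp
  qed
  finally show ?thesis using C by simp
qed

text \<open>Every vertex is covered at least once and those of \<open>A\<close> at least
  \<open>m + 1\<close> times, so the total multiplicity, at most \<open>t * D\<close>, is at least
  \<open>card V + m * card A\<close>.\<close>

lemma multiplicity_excess:
  assumes C: "clique C" "card C = t" "\<forall>c\<in>C. \<exists>d. R c d"
    and A: "A \<subseteq> V" "\<And>p. p \<in> A \<Longrightarrow> Suc m \<le> card {c \<in> C. p \<in> nonnbrs c}"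
  shows "m * card A \<le> excess"
proof -
  have finC: "finite C"
    by (rule finite_clique) fact
  have "1 + (if p \<in> A then m else 0) \<le> card {c \<in> C. p \<in> nonnbrs c}" if "p \<in> V" for p
  proof (cases "p \<in> A")
    case False
    have "{c \<in> C. p \<in> nonnbrs c} \<noteq> {}"
      using max_clique_covers[OF C(1,2) that] by auto
    then show ?thesis
      using False finC by (simp add: Suc_le_eq card_gt_0_iff)
  qed (use A in auto)
  then have "(\<Sum>p\<in>V. 1 + (if p \<in> A then m else 0)) \<le> (\<Sum>p\<in>V. card {c \<in> C. p \<in> nonnbrs c})"
    by (rule sum_mono)
  also have "\<dots> \<le> t * D"
    by (rule sum_multiplicity_le[OF C])
  also have "(\<Sum>p\<in>V. 1 + (if p \<in> A then m else 0)) = card V + m * card A"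
    using A(1) finite_V by (simp add: sum.distrib sum.If_cases Int_absorb1 del: One_nat_def)
  finally show ?thesis
    by (simp add: excess_def)
qed

lemma card_overlap:
  assumes "clique C" "card C = t" "\<forall>c\<in>C. \<exists>d. R c d"
  shows "card (overlap C) \<le> excess"
proof -
  have finC: "finite C"
    by (rule finite_clique) fact
  have "Suc 1 \<le> card {c \<in> C. p \<in> nonnbrs c}" if p: "p \<in> overlap C" for p
  proof -
    obtain x y where "x \<in> C" "y \<in> C" "x \<noteq> y" "p \<in> nonnbrs x" "p \<in> nonnbrs y"
      using p by (auto simp: overlap_def)
    then have "card {x, y} \<le> card {c \<in> C. p \<in> nonnbrs c}"
      using finC by (intro card_mono) auto
    then show ?thesis using \<open>x \<noteq> y\<close> by simp
  qed
  then show ?thesis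
    using multiplicity_excess[OF assms, of "overlap C" 1] by (auto simp: overlap_def)
qed

text \<open>An isolated vertex is a non-neighbour of all \<open>t\<close> members of a maximum
  clique, so its surplus multiplicity is \<open>t - 1\<close>.\<close>

lemma card_isolated:
  assumes "R x y"
  shows "(t - 1) * card isolated \<le> excess"
proof -
  obtain C where C: "clique C" "card C = t" "x \<in> C" "\<forall>c\<in>C. \<exists>d. R c d"
    using exists_max_clique[OF assms] by blast
  have "{c \<in> C. p \<in> nonnbrs c} = C" if "p \<in> isolated" for p
    using that R_sym by (auto simp: isolated_def nonnbrs_def)
  then show ?thesis
    using multiplicity_excess[OF C(1,2,4), of isolated "t - 1"] C t_ge_2
    by (auto simp: isolated_def)
qed

text \<open>Outside the overlap, \<open>q\<close> may replace \<open>c\<close> in the clique, so an edge \<open>q q'\<close> would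
  create a clique with one more vertex.\<close>

lemma nonnbrs_of_same_class:
  assumes C: "clique C" "card C = t" "c \<in> C"
    and q: "q \<in> nonnbrs c" "q \<notin> overlap C" and q': "q' \<in> nonnbrs c" "q' \<notin> overlap C"
  shows "q' \<in> nonnbrs q"
proof (rule ccontr)
  assume "q' \<notin> nonnbrs q"
  then have R: "R q q'" "q \<in> V" "q' \<in> V"
    using q q' by (auto simp: nonnbrs_def)
  have nbr: "R d p" if "p \<in> nonnbrs c" "p \<notin> overlap C" "d \<in> C - {c}" for p d
    using that C by (auto simp: overlap_def nonnbrs_def)
  have finC: "finite C"
    by (rule finite_clique) fact
  define C' where "C' = insert q (insert q' (C - {c}))"
  have "q \<notin> C - {c}" "q' \<notin> C - {c}" "q \<noteq> q'"
    using nbr q q' R R_irrefl by blast+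
  then have "card C' = Suc t"
    using finC C t_ge_2 unfolding C'_def by (simp add: card_Diff_singleton)
  moreover have "clique C'"
    unfolding clique_def
  proof (intro conjI ballI impI)
    show "C' \<subseteq> V"
      using R C by (auto simp: C'_def clique_def)
    fix a b assume "a \<in> C'" "b \<in> C'" "a \<noteq> b"
    moreover have "R a b" if "a \<in> C - {c}" "b \<in> C - {c}" "a \<noteq> b"
      using C that by (auto simp: clique_def)
    ultimately show "R a b"
      using R nbr[OF q] nbr[OF q'] R_sym unfolding C'_def by blast
  qed
  ultimately show False
    using clique_card_ne by blast
qed

text \<open>For a maximum clique \<open>C\<close> through \<open>p\<close>, the part of
  \<open>nonnbrs p\<close> outside \<open>overlap C\<close> is independent. Hence every edge inside
  \<open>nonnbrs p\<close> has an endpoint in the overlap; the factor 2 accounts for which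
  one.\<close>

lemma card_edges_in_nonnbrs:
  assumes "p \<in> V - isolated"
  shows "card {(v, x). R v x \<and> v \<in> nonnbrs p \<and> x \<in> nonnbrs p} \<le> 2 * excess * D"
proof -
  obtain y where y: "R p y"
    using assms by (auto simp: isolated_def)
  obtain C where C: "clique C" "card C = t" "p \<in> C" "\<forall>c\<in>C. \<exists>d. R c d"
    using exists_max_clique[OF y] by blast
  have fin: "finite (overlap C)"
    using finite_V by (simp add: overlap_def)
  have "{(v, x). R v x \<and> v \<in> nonnbrs p \<and> x \<in> nonnbrs p}
      \<subseteq> overlap C \<times> nonnbrs p \<union> nonnbrs p \<times> overlap C"
    using nonnbrs_of_same_class[OF C(1-3)] by (auto simp: nonnbrs_def)
  then have "card {(v, x). R v x \<and> v \<in> nonnbrs p \<and> x \<in> nonnbrs p}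
      \<le> card (overlap C \<times> nonnbrs p \<union> nonnbrs p \<times> overlap C)"
    using fin by (intro card_mono) auto
  also have "\<dots> \<le> card (overlap C \<times> nonnbrs p) + card (nonnbrs p \<times> overlap C)"
    by (rule card_Un_le)
  also have "\<dots> = 2 * card (overlap C) * card (nonnbrs p)"
    by (simp add: card_cartesian_product)
  also have "\<dots> \<le> 2 * excess * D"
    using card_overlap[OF C(1,2,4)] card_nonnbrs[OF y] by (intro mult_mono) auto
  finally show ?thesis .
qed

text \<open>Count the triples by \<open>p\<close> first. A non-isolated \<open>p\<close> sees few
  edges among its non-neighbours; an isolated \<open>p\<close> may see all of them, but there are
  few such \<open>p\<close>. The factor \<open>t - 1\<close> avoids dividing in the bound of
  \<open>card_isolated\<close>.\<close>

lemma sum_common_nonnbrs_le: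
  assumes "R a b"
  shows "(t - 1) * (\<Sum>v\<in>V. \<Sum>x\<in>V. if R v x then card (nonnbrs v \<inter> nonnbrs x) else 0)
    \<le> excess * (card V)\<^sup>2 + (t - 1) * (card V * (2 * excess * D))"
proof -
  let ?E = "\<lambda>p. {(v, x). R v x \<and> v \<in> nonnbrs p \<and> x \<in> nonnbrs p}"
  have indicator: "(if R v x then card (nonnbrs v \<inter> nonnbrs x) else 0)
      = (\<Sum>p\<in>V. of_bool ((v, x) \<in> ?E p))" if "v \<in> V" "x \<in> V" for v x
  proof -
    have "{p \<in> V. (v, x) \<in> ?E p} = (if R v x then nonnbrs v \<inter> nonnbrs x else {})"
      using that R_sym by (auto simp: nonnbrs_def)
    moreover have "(\<Sum>p\<in>V. of_bool ((v, x) \<in> ?E p)) = card {p \<in> V. (v, x) \<in> ?E p}"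
      using finite_V by (simp add: of_bool_def sum.If_cases Int_def)
    ultimately show ?thesis by simp
  qed
  have "(\<Sum>v\<in>V. \<Sum>x\<in>V. if R v x then card (nonnbrs v \<inter> nonnbrs x) else 0)
      = (\<Sum>v\<in>V. \<Sum>x\<in>V. \<Sum>p\<in>V. of_bool ((v, x) \<in> ?E p))"
    using indicator by (intro sum.cong refl) blast
  also have "\<dots> = (\<Sum>vx\<in>V \<times> V. \<Sum>p\<in>V. of_bool (vx \<in> ?E p))"
    by (subst sum.cartesian_product) (auto intro!: sum.cong)
  also have "\<dots> = (\<Sum>p\<in>V. \<Sum>vx\<in>V \<times> V. of_bool (vx \<in> ?E p))"
    by (rule sum.swap)
  also have "\<dots> = (\<Sum>p\<in>V. card (?E p))"
  proof (intro sum.cong refl)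
    fix p
    have "V \<times> V \<inter> ?E p = ?E p"
      by (auto simp: nonnbrs_def)
    then show "(\<Sum>vx\<in>V \<times> V. of_bool (vx \<in> ?E p)) = card (?E p)"
      using finite_V by (simp add: of_bool_def sum.If_cases)
  qed
  also have "\<dots> \<le> (\<Sum>p\<in>V. (if p \<in> isolated then (card V)\<^sup>2 else 0) + 2 * excess * D)"
  proof (rule sum_mono)
    fix p assume p: "p \<in> V"
    show "card (?E p) \<le> (if p \<in> isolated then (card V)\<^sup>2 else 0) + 2 * excess * D"
    proof (cases "p \<in> isolated")
      case True
      have "card (?E p) \<le> card (V \<times> V)"
        using finite_V by (intro card_mono) (auto simp: nonnbrs_def)
      then show ?thesis
        using True by (simp add: card_cartesian_product power2_eq_square)
    qed (use p card_edges_in_nonnbrs in auto)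
  qed
  also have "\<dots> = card isolated * (card V)\<^sup>2 + card V * (2 * excess * D)"
  proof -
    have "V \<inter> isolated = isolated"
      by (auto simp: isolated_def)
    then show ?thesis
      using finite_V by (simp add: sum.distrib sum.If_cases)
  qed
  finally have "(t - 1) * (\<Sum>v\<in>V. \<Sum>x\<in>V. if R v x then card (nonnbrs v \<inter> nonnbrs x) else 0)
      \<le> (t - 1) * (card isolated * (card V)\<^sup>2 + card V * (2 * excess * D))"
    by (rule mult_left_mono) simp
  also have "\<dots> = ((t - 1) * card isolated) * (card V)\<^sup>2 + (t - 1) * (card V * (2 * excess * D))"
    by (simp add: algebra_simps)
  also have "\<dots> \<le> excess * (card V)\<^sup>2 + (t - 1) * (card V * (2 * excess * D))"
    using card_isolated[OF assms] by (intro add_right_mono mult_right_mono) auto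
  finally show ?thesis .
qed

end

section \<open>Triple systems: cells cut out by two links, and the double count\<close>

text \<open>Each point contributes the size of its own fibre, so the sum equals the sum of the
  squared fibre sizes, and Cauchy-Schwarz applies.\<close>

lemma card_squared_le_sum_card_fibres:
  fixes f :: "'a \<Rightarrow> 'b"
  assumes "finite B" "finite I" "f ` B \<subseteq> I"
  shows "(card B)\<^sup>2 \<le> card I * (\<Sum>z\<in>B. card {p \<in> B. f p = f z})"
proof -
  let ?F = "\<lambda>i. {p \<in> B. f p = i}"
  have B: "card B = (\<Sum>i\<in>I. card (?F i))"
    using sum.group[OF assms, of "\<lambda>_. 1::nat"] by simp
  have "(\<Sum>z\<in>B. card (?F (f z))) = (\<Sum>i\<in>I. \<Sum>z\<in>?F i. card (?F (f z)))"
    using sum.group[OF assms, of "\<lambda>z. card (?F (f z))"] by simp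
  also have "\<dots> = (\<Sum>i\<in>I. (card (?F i))\<^sup>2)"
    by (intro sum.cong) (auto simp: power2_eq_square)
  finally have S: "(\<Sum>z\<in>B. card (?F (f z))) = (\<Sum>i\<in>I. (card (?F i))\<^sup>2)" .
  have "(\<Sum>i\<in>I. real (card (?F i)))\<^sup>2 \<le> (\<Sum>i\<in>I. (real (card (?F i)))\<^sup>2) * (\<Sum>i\<in>I. 1\<^sup>2)"
    using Cauchy_Schwarz_ineq_sum[of "\<lambda>i. real (card (?F i))" "\<lambda>_. 1" I] by simp
  then have "real ((card B)\<^sup>2) \<le> real (card I * (\<Sum>z\<in>B. card (?F (f z))))"
    unfolding S by (simp add: B mult.commute)
  then show ?thesis
    by linarith
qed

text \<open>Vertices \<open>z\<close> and \<open>p\<close> in the same cell share a class in the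
  link of \<open>v\<close> and one in the link of \<open>x\<close>. So \<open>p\<close> is a
  non-neighbour of \<open>z\<close> in both links, and each fibre lies in the intersection being
  counted.\<close>

lemma sum_common_nonnbrs_ge:
  fixes T :: "'a \<Rightarrow> 'a \<Rightarrow> 'a \<Rightarrow> bool"
  assumes link: "\<And>v. dense_clique_free_graph V (T v) t D"
    and swap: "\<And>a b c. T a b c \<Longrightarrow> T b a c" and vx: "T v x y"
  shows "(card V - D - 2 * (t * D - card V))\<^sup>2 \<le> (t - 1)\<^sup>2 *
    (\<Sum>z\<in>V. if T z v x
      then card ({p \<in> V. \<not> T z v p} \<inter> {p \<in> V. \<not> T z x p}) else 0)"
proof -
  interpret G: dense_clique_free_graph V "T v" t D
    by (rule link)
  interpret G': dense_clique_free_graph V "T x" t D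
    by (rule link)
  obtain C where C: "G.clique C" "card C = t" "x \<in> C" "\<forall>c\<in>C. \<exists>d. T v c d"
    using G.exists_max_clique[OF vx] by blast
  obtain C' where C': "G'.clique C'" "card C' = t" "v \<in> C'" "\<forall>c\<in>C'. \<exists>d. T x c d"
    using G'.exists_max_clique[OF swap[OF vx]] by blast
  have fin: "finite V" "finite C" "finite C'"
    using G.finite_V G.finite_clique G'.finite_clique C(1) C'(1) by blast+
  have swap_iff: "T a b c \<longleftrightarrow> T b a c" for a b c
    using swap by blast
  \<comment> \<open>The class of \<open>x\<close> in the link of \<open>v\<close> is also the class
    of \<open>v\<close> in the link of \<open>x\<close>. Removing this one set from \<open>V\<close>
    discards a class of both links and leaves \<open>t - 1\<close> classes in each.\<close>
  have xv: "G'.nonnbrs v = G.nonnbrs x"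
    by (simp only: G.nonnbrs_def G'.nonnbrs_def swap_iff[of x v])
  define B where "B = V - (G.nonnbrs x \<union> (G.overlap C \<union> G'.overlap C'))"
  have B: "z \<in> V" "T z v x" "z \<notin> G.overlap C" "z \<notin> G'.overlap C'"
    "z \<notin> G.nonnbrs x" "z \<notin> G'.nonnbrs v"
    if z: "z \<in> B" for z
  proof -
    have z: "z \<in> V" "z \<notin> G.nonnbrs x" "z \<notin> G.overlap C" "z \<notin> G'.overlap C'"
      using z unfolding B_def by blast+
    then have "T v x z"
      by (simp add: G.nonnbrs_def)
    then have "T z v x"
      by (rule swap[OF G.R_sym])
    with z show "z \<in> V" "T z v x" "z \<notin> G.overlap C" "z \<notin> G'.overlap C'"
      "z \<notin> G.nonnbrs x" "z \<notin> G'.nonnbrs v"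
      unfolding xv by blast+
  qed
  \<comment> \<open>On \<open>B\<close>, which avoids both overlaps, the chosen class is the only
    possible one.\<close>
  define g where "g = (\<lambda>z. SOME c. c \<in> C \<and> z \<in> G.nonnbrs c)"
  define g' where "g' = (\<lambda>z. SOME c. c \<in> C' \<and> z \<in> G'.nonnbrs c)"
  have g: "g z \<in> C" "z \<in> G.nonnbrs (g z)" if "z \<in> V" for z
    using someI_ex[of "\<lambda>c. c \<in> C \<and> z \<in> G.nonnbrs c"] G.max_clique_covers[OF C(1,2) that]
    unfolding g_def by blast+
  have g': "g' z \<in> C'" "z \<in> G'.nonnbrs (g' z)" if "z \<in> V" for z
    using someI_ex[of "\<lambda>c. c \<in> C' \<and> z \<in> G'.nonnbrs c"] G'.max_clique_covers[OF C'(1,2) that]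
    unfolding g'_def by blast+
  let ?I = "(C - {x}) \<times> (C' - {v})" and ?f = "\<lambda>z. (g z, g' z)"
  have "card (G.nonnbrs x \<union> (G.overlap C \<union> G'.overlap C'))
      \<le> card (G.nonnbrs x) + (card (G.overlap C) + card (G'.overlap C'))"
    by (meson add_left_mono card_Un_le order_trans)
  also have "\<dots> \<le> D + 2 * (t * D - card V)"
    using G.card_nonnbrs[OF vx] G.card_overlap[OF C(1,2,4)] G'.card_overlap[OF C'(1,2,4)]
    unfolding G.excess_def by linarith
  finally have "card V - D - 2 * (t * D - card V)
      \<le> card V - card (G.nonnbrs x \<union> (G.overlap C \<union> G'.overlap C'))"
    by linarith
  also have "\<dots> \<le> card B"
    unfolding B_def by (rule diff_card_le_card_Diff) (use fin in \<open>auto simp: G.overlap_def G'.overlap_def\<close>)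
  finally have "(card V - D - 2 * (t * D - card V))\<^sup>2 \<le> (card B)\<^sup>2"
    by (rule power_mono) simp
  also have "\<dots> \<le> card ?I * (\<Sum>z\<in>B. card {p \<in> B. ?f p = ?f z})"
  proof (rule card_squared_le_sum_card_fibres)
    show "?f ` B \<subseteq> ?I"
    proof (rule image_subsetI)
      fix z assume z: "z \<in> B"
      have "g z \<noteq> x" "g' z \<noteq> v"
        using g(2)[of z] g'(2)[of z] B[OF z] by metis+
      then show "?f z \<in> ?I"
        using g(1)[of z] g'(1)[of z] B(1)[OF z] by simp
    qed
  qed (use fin in \<open>auto simp: B_def\<close>)
  also have "card ?I = (t - 1)\<^sup>2"
    using C C' fin by (simp add: card_cartesian_product power2_eq_square)
  also have "(\<Sum>z\<in>B. card {p \<in> B. ?f p = ?f z})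
      \<le> (\<Sum>z\<in>B. card ({p \<in> V. \<not> T z v p} \<inter> {p \<in> V. \<not> T z x p}))"
  proof (intro sum_mono card_mono subsetI)
    fix z p assume z: "z \<in> B" and "p \<in> {p \<in> B. ?f p = ?f z}"
    then have p: "p \<in> B" "g p = g z" "g' p = g' z"
      by auto
    have "p \<in> G.nonnbrs z"
      using G.nonnbrs_of_same_class[OF C(1,2), of "g z" z p] g B z p by metis
    moreover have "p \<in> G'.nonnbrs z"
      using G'.nonnbrs_of_same_class[OF C'(1,2), of "g' z" z p] g' B z p by metis
    ultimately show "p \<in> {p \<in> V. \<not> T z v p} \<inter> {p \<in> V. \<not> T z x p}"
      by (simp add: G.nonnbrs_def G'.nonnbrs_def swap_iff[of z])
  qed (use fin in auto)
  also have "\<dots> = (\<Sum>z\<in>B. if T z v x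
      then card ({p \<in> V. \<not> T z v p} \<inter> {p \<in> V. \<not> T z x p}) else 0)"
    using B by (intro sum.cong) auto
  also have "\<dots> \<le> (\<Sum>z\<in>V. if T z v x
      then card ({p \<in> V. \<not> T z v p} \<inter> {p \<in> V. \<not> T z x p}) else 0)"
    using fin by (intro sum_mono2) (auto simp: B_def)
  finally show ?thesis by simp
qed

text \<open>Double counting of the quadruples \<open>(v, x, z, p)\<close> such that \<open>vxz\<close> is an edge while neither
  \<open>vzp\<close> nor \<open>xzp\<close> is, from below by fixing \<open>v, x\<close> and from above by fixing \<open>z\<close>.\<close>

lemma triple_system_inequality:
  fixes T :: "'a \<Rightarrow> 'a \<Rightarrow> 'a \<Rightarrow> bool"
  assumes link: "\<And>v. dense_clique_free_graph V (T v) t D"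
    and swap: "\<And>a b c. T a b c \<Longrightarrow> T b a c" and edge: "T a0 b0 c0"
  defines "n \<equiv> card V" and "K \<equiv> t * D - card V"
  shows "(n - D) * (n - D - 2 * K)\<^sup>2 \<le> (t - 1) * (K * n\<^sup>2) + (t - 1)\<^sup>2 * (n * (2 * K * D))"
proof -
  interpret L: dense_clique_free_graph V "T v" t D for v
    by (rule link)
  note fin = L.finite_V
  define F where "F = (\<lambda>v x z. if T z v x
      then card ({p \<in> V. \<not> T z v p} \<inter> {p \<in> V. \<not> T z x p}) else 0)"
  \<comment> \<open>Both bounds need a nonempty link. The lower one is summed over \<open>v\<close>
    in \<open>Z\<close>, the upper one over \<open>z\<close> in \<open>Z\<close>, so the factor
    \<open>card Z\<close> cancels.\<close>
  define Z where "Z = {v \<in> V. \<exists>x y. T v x y}"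
  let ?l = "(n - D - 2 * K)\<^sup>2" and ?u = "K * n\<^sup>2 + (t - 1) * (n * (2 * K * D))"
  have finZ: "finite Z"
    using fin by (simp add: Z_def)
  have T_in: "a \<in> V" "b \<in> V" "c \<in> V" if "T a b c" for a b c
    using L.R_in_V[OF swap[OF that]] L.R_in_V[OF that] L.R_in_V[OF L.R_sym[OF that]] by blast+
  have "a0 \<in> Z"
    using edge T_in by (auto simp: Z_def)
  then have posZ: "card Z > 0"
    using finZ card_gt_0_iff by blast
  have lower: "(n - D) * ?l \<le> (t - 1)\<^sup>2 * (\<Sum>x\<in>V. \<Sum>z\<in>V. F v x z)" if v: "v \<in> Z" for v
  proof -
    obtain x0 y0 where xy: "T v x0 y0"
      using v by (auto simp: Z_def)
    \<comment> \<open>The neighbours of \<open>x0\<close> in the link of \<open>v\<close> provide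
      \<open>n - D\<close> vertices \<open>x\<close> for which the pair \<open>v x\<close> has
      positive codegree.\<close>
    let ?P = "{x \<in> V. T v x0 x}"
    have "?P = V - L.nonnbrs v x0"
      by (auto simp: L.nonnbrs_def)
    then have "n - card (L.nonnbrs v x0) \<le> card ?P"
      unfolding n_def by (simp add: diff_card_le_card_Diff)
    then have "n - D \<le> card ?P"
      using L.card_nonnbrs[OF xy] by linarith
    then have "(n - D) * ?l \<le> card ?P * ?l"
      by (rule mult_right_mono) simp
    also have "\<dots> \<le> (\<Sum>x\<in>?P. (t - 1)\<^sup>2 * (\<Sum>z\<in>V. F v x z))"
    proof (intro sum_bounded_below[where 'a=nat, simplified])
      fix x assume "x \<in> ?P"
      then have "T v x x0"
        using L.R_sym by simp
      with sum_common_nonnbrs_ge[where T = T, OF link swap]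
      show "?l \<le> (t - 1)\<^sup>2 * (\<Sum>z\<in>V. F v x z)"
        unfolding F_def n_def K_def by simp
    qed
    also have "\<dots> \<le> (\<Sum>x\<in>V. (t - 1)\<^sup>2 * (\<Sum>z\<in>V. F v x z))"
      using fin by (intro sum_mono2) auto
    finally show ?thesis
      by (simp add: sum_distrib_left)
  qed
  have upper: "(t - 1) * (\<Sum>v\<in>V. \<Sum>x\<in>V. F v x z) \<le> ?u" if z: "z \<in> Z" for z
  proof -
    obtain x0 y0 where xy: "T z x0 y0"
      using z by (auto simp: Z_def)
    show ?thesis
      using L.sum_common_nonnbrs_le[OF xy]
      unfolding F_def L.nonnbrs_def L.excess_def n_def K_def .
  qed
  have "card Z * ((n - D) * ?l) \<le> (\<Sum>v\<in>Z. (t - 1)\<^sup>2 * (\<Sum>x\<in>V. \<Sum>z\<in>V. F v x z))"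
    using lower by (intro sum_bounded_below[where 'a=nat, simplified]) blast
  also have "\<dots> \<le> (\<Sum>v\<in>V. (t - 1)\<^sup>2 * (\<Sum>x\<in>V. \<Sum>z\<in>V. F v x z))"
    using fin by (intro sum_mono2) (auto simp: Z_def)
  also have "\<dots> = (t - 1)\<^sup>2 * (\<Sum>v\<in>V. \<Sum>x\<in>V. \<Sum>z\<in>V. F v x z)"
    by (simp add: sum_distrib_left)
  also have "(\<Sum>v\<in>V. \<Sum>x\<in>V. \<Sum>z\<in>V. F v x z) = (\<Sum>v\<in>V. \<Sum>z\<in>V. \<Sum>x\<in>V. F v x z)"
    by (intro sum.cong refl sum.swap)
  also have "\<dots> = (\<Sum>z\<in>V. \<Sum>v\<in>V. \<Sum>x\<in>V. F v x z)"
    by (rule sum.swap)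
  also have "\<dots> = (\<Sum>z\<in>Z. \<Sum>v\<in>V. \<Sum>x\<in>V. F v x z)"
    using fin by (intro sum.mono_neutral_right) (auto simp: Z_def F_def)
  \<comment> \<open>One factor \<open>t - 1\<close> goes inside to match the form of
    \<open>upper\<close>.\<close>
  also have "(t - 1)\<^sup>2 * \<dots> = (t - 1) * (\<Sum>z\<in>Z. (t - 1) * (\<Sum>v\<in>V. \<Sum>x\<in>V. F v x z))"
    by (simp add: sum_distrib_left power2_eq_square mult.assoc)
  also have "\<dots> \<le> (t - 1) * (card Z * ?u)"
    using upper by (intro mult_left_mono sum_bounded_above[where 'a=nat, simplified]) auto
  finally have "card Z * ((n - D) * ?l) \<le> card Z * ((t - 1) * ?u)"
    by (simp only: mult.left_commute[of "card Z" "t - 1"])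
  then have "(n - D) * ?l \<le> (t - 1) * ?u"
    using posZ by simp
  then show ?thesis
    by (simp only: distrib_left power2_eq_square mult.assoc)
qed

section \<open>The numerical contradiction\<close>

text \<open>Here \<open>d\<close> and \<open>k\<close> stand for \<open>D / n\<close> and
  \<open>K / n\<close>. With \<open>u = 1 / t\<close>, the left side is at most
  \<open>(1 - u) / 9\<close> and the right side at least \<open>(1 - u) / 5\<close>.\<close>

lemma triple_system_inequality_fails:
  fixes t d k :: real
  assumes t: "t \<ge> 2" and k: "0 \<le> k" "k \<le> 1 / (36 * t)" and d: "0 \<le> d" "d \<le> 1 / t + 1 / (36 * t\<^sup>2)"
  shows "(t - 1) * k + (t - 1)\<^sup>2 * (2 * k * d) < (1 - d) * (1 - d - 2 * k)\<^sup>2"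
proof -
  define u where "u = 1 / t"
  have u: "0 < u" "u \<le> 1 / 2" and tu: "t * u = 1"
    using t by (auto simp: u_def field_simps)
  have k: "0 \<le> k" "k \<le> u / 36" and d: "0 \<le> d" "d \<le> u + u\<^sup>2 / 36"
    using k d by (auto simp: u_def field_simps power2_eq_square)
  have u2: "u\<^sup>2 \<le> u / 2"
    using mult_left_mono[OF u(2), of u] u by (simp add: power2_eq_square)
  have tk: "(t - 1) * k \<le> (1 - u) / 36"
  proof -
    have "(t - 1) * k \<le> (t - 1) * (u / 36)"
      using t k by (intro mult_left_mono) auto
    also have "\<dots> = (1 - u) / 36"
      using tu by (simp add: algebra_simps diff_divide_distrib)
    finally show ?thesis .
  qed
  \<comment> \<open>As \<open>u <= 1 / 2\<close>, the term \<open>u\<^sup>2 / 36\<close> is at most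
    \<open>u / 72\<close>, so \<open>d <= u * (73 / 72)\<close>.\<close>
  have td: "(t - 1) * d \<le> (1 - u) * (73 / 72)"
  proof -
    have "(t - 1) * d \<le> (t - 1) * (u * (73 / 72))"
      using t d u2 by (intro mult_left_mono) auto
    also have "\<dots> = (t * u - u) * (73 / 72)"
      by (simp only: left_diff_distrib mult.assoc mult_1)
    also have "\<dots> = (1 - u) * (73 / 72)"
      by (simp only: tu)
    finally show ?thesis .
  qed
  have "(t - 1) * k + (t - 1)\<^sup>2 * (2 * k * d) = (t - 1) * k * (1 + 2 * ((t - 1) * d))"
    by (simp add: algebra_simps power2_eq_square)
  also have "\<dots> \<le> (1 - u) / 36 * (1 + 2 * ((1 - u) * (73 / 72)))"
    using tk td t k d u by (intro mult_mono) auto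
  also have "\<dots> \<le> (1 - u) / 36 * (4 * 1)"
    using u by (intro mult_left_mono) auto
  also have "\<dots> < (1 - u) * (4 / 5) * (1 / 4)"
    using u by simp
  also have "\<dots> \<le> (1 - u) * (4 / 5) * (1 - u)\<^sup>2"
    using u power_mono[of "1 / 2" "1 - u" 2] by (intro mult_left_mono) (auto simp: power2_eq_square)
  \<comment> \<open>Since \<open>u <= 1 - u\<close>, the losses \<open>u / 72\<close> in
    \<open>1 - d\<close> and \<open>5 * u / 72\<close> in \<open>1 - d - 2 * k\<close> are at most
    those fractions of \<open>1 - u\<close>.\<close>
  also have "\<dots> \<le> (1 - u) * ((71 / 72) * (67 / 72)\<^sup>2) * (1 - u)\<^sup>2"
    using u by (intro mult_right_mono mult_left_mono) (auto simp: power2_eq_square)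
  also have "\<dots> = ((1 - u) * (71 / 72)) * ((1 - u) * (67 / 72))\<^sup>2"
    by (simp only: power_mult_distrib mult.assoc mult.commute mult.left_commute)
  also have "\<dots> \<le> (1 - d) * (1 - d - 2 * k)\<^sup>2"
    using u d k u2 by (intro mult_mono power_mono) auto
  finally show ?thesis .
qed

section \<open>Positive codegree and copies of daisies\<close>

lemma set_degree_eq_card_extensions:
  assumes H: "r_graph r H" and S: "S \<in> nsets (verts H) (r - 1)" and r: "r \<ge> 1"
  shows "set_degree H S = card {u \<in> verts H - S. insert u S \<in> edges H}"
proof -
  let ?A = "{u \<in> verts H - S. insert u S \<in> edges H}"
  have finS: "finite S" and cardS: "card S = r - 1"
    using S by (auto simp: nsets_def)
  have "bij_betw (\<lambda>u. insert u S) ?A {e \<in> edges H. S \<subseteq> e}"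
  proof (rule bij_betwI')
    fix e assume e: "e \<in> {e \<in> edges H. S \<subseteq> e}"
    then have "finite e" "card e = r" "e \<subseteq> verts H"
      using H by (auto simp: r_graph_def nsets_def)
    then have "card (e - S) = 1"
      using e finS cardS r by (simp add: card_Diff_subset)
    then obtain u where u: "e - S = {u}"
      using card_1_singletonE by blast
    then have "e = insert u S"
      using e by auto
    then show "\<exists>u\<in>?A. e = insert u S"
      using u e \<open>e \<subseteq> verts H\<close> by auto
  qed auto
  then show ?thesis
    by (simp add: set_degree_def bij_betw_same_card)
qed

lemma finite_edges: "r_graph r H \<Longrightarrow> finite (edges H)"
  by (auto simp: r_graph_def intro: finite_subset finite_imp_finite_nsets)

lemma set_degree_pos_iff:
  "r_graph r H \<Longrightarrow> set_degree H S > 0 \<longleftrightarrow> (\<exists>e\<in>edges H. S \<subseteq> e)"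
  using finite_edges[of r H] by (auto simp: set_degree_def card_gt_0_iff)

lemma finite_positive_degrees:
  assumes "r_graph r H"
  shows "finite {set_degree H S | S. S \<in> nsets (verts H) k \<and> set_degree H S > 0}"
proof (rule finite_subset)
  show "finite (set_degree H ` nsets (verts H) k)"
    using assms by (auto simp: r_graph_def finite_imp_finite_nsets)
qed auto

lemma pos_codegree_le_set_degree:
  assumes "r_graph r H" "S \<in> nsets (verts H) (r - 1)" "set_degree H S > 0"
  shows "pos_codegree r H \<le> set_degree H S"
  unfolding pos_codegree_def using assms by (intro Min_le finite_positive_degrees) auto

lemma pos_codegree_attained:
  assumes H: "r_graph r H" and "r \<ge> 1" "edges H \<noteq> {}"
  shows "\<exists>S. S \<in> nsets (verts H) (r - 1) \<and> set_degree H S > 0 \<and> set_degree H S = pos_codegree r H"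
proof -
  obtain e where e: "e \<in> edges H"
    using assms by auto
  then have e': "finite e" "card e = r" "e \<subseteq> verts H"
    using H by (auto simp: r_graph_def nsets_def)
  then obtain x where "x \<in> e"
    using \<open>r \<ge> 1\<close> by fastforce
  then have "e - {x} \<in> nsets (verts H) (r - 1)" "set_degree H (e - {x}) > 0"
    using e e' set_degree_pos_iff[OF H] by (auto simp: nsets_def)
  then have "{set_degree H S | S. S \<in> nsets (verts H) (r - 1) \<and> set_degree H S > 0} \<noteq> {}"
    by blast
  from Min_in[OF finite_positive_degrees[OF H] this] show ?thesis
    unfolding pos_codegree_def[symmetric] by auto
qed

text \<open>\<open>C\<close> receives the complete graph and \<open>P\<close> the
  \<open>r - 2\<close> added vertices; the embedding glues two bijections.\<close>

lemma contains_daisyI: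
  assumes C: "finite C" "card C = t" and P: "finite P" "card P = r - 2"
    and disj: "C \<inter> P = {}" and sub: "C \<union> P \<subseteq> verts H"
    and edges: "\<And>x y. \<lbrakk>x \<in> C; y \<in> C; x \<noteq> y\<rbrakk> \<Longrightarrow> P \<union> {x, y} \<in> edges H"
  shows "contains_copy H (daisy r t)"
proof -
  let ?I = "{t..<t + (r - 2)}"
  obtain f where f: "bij_betw f {..<t} C"
    using finite_same_card_bij[of "{..<t}" C] C by auto
  obtain g where g: "bij_betw g ?I P"
    using finite_same_card_bij[of ?I P] P by auto
  define h where "h = (\<lambda>i. if i < t then f i else g i)"
  have hf: "bij_betw h {..<t} C"
    using f by (subst bij_betw_cong[of _ h f]) (auto simp: h_def)
  have hg: "bij_betw h ?I P"
    using g by (subst bij_betw_cong[of _ h g]) (auto simp: h_def)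
  have split: "{..<t + (r - 2)} = {..<t} \<union> ?I"
    by auto
  have h: "bij_betw h {..<t + (r - 2)} (C \<union> P)"
    unfolding split using hf hg disj by (rule bij_betw_combine)
  show ?thesis
    unfolding contains_copy_def
  proof (intro exI[of _ h] conjI ballI)
    show "inj_on h (verts (daisy r t))" "h ` verts (daisy r t) \<subseteq> verts H"
      using h sub by (auto simp: daisy_def bij_betw_def)
    fix e assume "e \<in> edges (daisy r t)"
    then obtain e' where e': "e = e' \<union> ?I" "e' \<subseteq> {..<t}" "card e' = 2"
      by (auto simp: daisy_def nsets_def)
    then obtain a b where ab: "e' = {a, b}" "a \<noteq> b"
      by (auto simp: card_2_iff)
    then have "h a \<in> C" "h b \<in> C" "h a \<noteq> h b"
      using hf e' by (auto simp: bij_betw_def inj_on_def)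
    then have "P \<union> {h a, h b} \<in> edges H"
      by (rule edges)
    also have "P \<union> {h a, h b} = h ` e"
      using hg by (auto simp: e' ab bij_betw_def)
    finally show "h ` e \<in> edges H" .
  qed
qed

section \<open>The bound for a single daisy-free graph\<close>

text \<open>\<open>T\<close> is the triple system linked to an \<open>(r - 3)\<close>-set
  \<open>S\<close>. A clique on \<open>t + 1\<close> vertices in the link of \<open>v\<close> forms
  a daisy together with \<open>insert v S\<close>, so all links satisfy the locale and the double
  count applies.\<close>

lemma pos_codegree_daisy_free_le:
  fixes H :: "'a hypergraph"
  assumes r: "r \<ge> 3" and t: "t \<ge> 2" and H: "r_graph r H" and ne: "edges H \<noteq> {}"
    and free: "\<not> contains_copy H (daisy r (t + 1))"
  shows "real (pos_codegree r H)
    \<le> (1 - 1 / real t - 1 / (36 * (real t)\<^sup>2)) * real (card (verts H))"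
proof (rule ccontr)
  define V where "V = verts H"
  define n where "n = card V"
  define D where "D = n - pos_codegree r H"
  define K where "K = t * D - n"
  define u where "u = 1 / real t"
  assume "\<not> ?thesis"
  then have big: "real (pos_codegree r H) > (1 - u - u\<^sup>2 / 36) * real n"
    by (simp add: u_def n_def V_def power2_eq_square mult.commute)
  have finV: "finite V"
    using H by (simp add: r_graph_def V_def)
  have edgeD: "finite e" "card e = r" "e \<subseteq> V" if "e \<in> edges H" for e
    using H that by (auto simp: r_graph_def nsets_def V_def)
  obtain e0 where e0: "e0 \<in> edges H"
    using ne by auto
  \<comment> \<open>Taking \<open>S\<close> inside an edge guarantees that \<open>T\<close> is
    nonempty.\<close>
  obtain S where S: "S \<subseteq> e0" "card S = r - 3" "finite S"
    using obtain_subset_with_card_n[of "r - 3" e0] edgeD[OF e0] by auto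
  have "card (e0 - S) = 3"
    using S edgeD[OF e0] r by (simp add: card_Diff_subset)
  then obtain a0 b0 c0 where abc: "e0 - S = {a0, b0, c0}" "a0 \<noteq> b0" "b0 \<noteq> c0" "a0 \<noteq> c0"
    by (auto simp: card_3_iff)
  have npos: "n > 0"
    using edgeD[OF e0] r finV by (auto simp: n_def card_gt_0_iff)
  define T where "T = (\<lambda>a b c. a \<noteq> b \<and> b \<noteq> c \<and> a \<noteq> c \<and> {a, b, c} \<inter> S = {} \<and>
    S \<union> {a, b, c} \<in> edges H)"
  have T0: "T a0 b0 c0"
  proof -
    have "S \<union> {a0, b0, c0} = e0"
      using abc S by blast
    moreover have "{a0, b0, c0} \<inter> S = {}"
      using abc by blast
    ultimately show ?thesis
      using abc e0 by (simp add: T_def)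
  qed
  have codegree: "pos_codegree r H \<le> card {z \<in> V. T v x z}" if T: "T v x y" for v x y
  proof -
    let ?S = "S \<union> {v, x}"
    have vx: "v \<noteq> x" "v \<notin> S" "x \<notin> S" and e: "insert y ?S \<in> edges H"
      using T by (auto simp: T_def insert_commute)
    have S': "?S \<in> nsets (verts H) (r - 1)"
      using edgeD[OF e] vx S r by (auto simp: nsets_def V_def)
    have "set_degree H ?S > 0"
      using set_degree_pos_iff[OF H] e by blast
    then have "pos_codegree r H \<le> set_degree H ?S"
      by (rule pos_codegree_le_set_degree[OF H S'])
    also have "\<dots> = card {u \<in> V - ?S. insert u ?S \<in> edges H}"
      using r by (simp only: set_degree_eq_card_extensions[OF H S'] V_def)
    also have "{u \<in> V - ?S. insert u ?S \<in> edges H} = {z \<in> V. T v x z}"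
      using vx by (auto simp: T_def insert_commute)
    finally show ?thesis .
  qed
  have "pos_codegree r H \<le> n"
    using codegree[OF T0] card_mono[OF finV, of "{z \<in> V. T a0 b0 z}"] by (simp add: n_def)
  then have "real D = real n - real (pos_codegree r H)"
    by (simp add: D_def of_nat_diff)
  then have D: "real D \<le> (u + u\<^sup>2 / 36) * real n"
    using big by (simp add: algebra_simps)
  have u: "0 < u" "u \<le> 1 / 2" and tu: "real t * u = 1"
    using t by (auto simp: u_def field_simps)
  have u2: "u\<^sup>2 \<le> u / 2"
    using mult_left_mono[OF u(2), of u] u by (simp add: power2_eq_square)
  have tD: "real t * real D \<le> (1 + u / 36) * real n"
  proof -
    have "real t * real D \<le> real t * ((u + u\<^sup>2 / 36) * real n)"
      using D by (rule mult_left_mono) simp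
    also have "\<dots> = ((real t * u) + (real t * u) * u / 36) * real n"
      by (simp add: algebra_simps power2_eq_square)
    finally show ?thesis
      by (simp add: tu)
  qed
  \<comment> \<open>The point is \<open>(t - 1) * (u + u\<^sup>2 / 36) = 1 - u + u / 36 - u\<^sup>2
    / 36 < 1\<close>.\<close>
  have small_D: "(t - 1) * D < card V"
  proof -
    have "(real t - 1) * real D \<le> (real t - 1) * ((u + u\<^sup>2 / 36) * real n)"
      using D t by (intro mult_left_mono) auto
    also have "\<dots> = ((real t * u) + (real t * u) * u / 36 - u - u\<^sup>2 / 36) * real n"
      by (simp add: field_simps power2_eq_square)
    also have "\<dots> < 1 * real n"
    proof (rule mult_strict_right_mono)
      show "real t * u + real t * u * u / 36 - u - u\<^sup>2 / 36 < 1"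
        unfolding tu using u zero_le_power2[of u] by linarith
    qed (use npos in simp)
    finally have "real ((t - 1) * D) < real n"
      using t by (simp add: of_nat_diff)
    then show ?thesis
      by (simp only: n_def of_nat_less_iff)
  qed
  have link: "dense_clique_free_graph V (T v) t D" for v
  proof
    show "finite V" "t \<ge> 2" "(t - 1) * D < card V"
      by fact+
    show "x \<in> V" "T v y x" if "T v x y" for x y
      using that edgeD(3) by (auto simp: T_def insert_commute)
    show "\<not> T v x x" for x
      by (simp add: T_def)
    show "card {z \<in> V. \<not> T v x z} \<le> D" if "T v x y" for x y
    proof -
      have "{z \<in> V. \<not> T v x z} = V - {z \<in> V. T v x z}"
        by auto
      then show ?thesis
        using codegree[OF that] finV by (simp add: card_Diff_subset D_def n_def)
    qed
    show "\<exists>x\<in>C. \<exists>y\<in>C. x \<noteq> y \<and> \<not> T v x y" if C: "C \<subseteq> V" "card C = Suc t" for C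
    proof (rule ccontr)
      assume "\<not> ?thesis"
      then have clique: "T v x y" if "x \<in> C" "y \<in> C" "x \<noteq> y" for x y
        using that by blast
      \<comment> \<open>Disjointness of \<open>x\<close> from \<open>insert v S\<close> can be read
        off only from a triple containing \<open>x\<close>, which takes a second member of the
        clique.\<close>
      have other: "\<exists>y\<in>C. y \<noteq> x" for x
      proof (rule ccontr)
        assume "\<not> ?thesis"
        then have "C \<subseteq> {x}" by auto
        then have "card C \<le> 1"
          using card_mono[of "{x}" C] by simp
        then show False using C t by simp
      qed
      have disj: "x \<noteq> v" "x \<notin> S" if x: "x \<in> C" for x
        using other[of x] clique[OF x] by (auto simp: T_def)
      obtain x y where xy: "T v x y"
        using other clique by blast
      then have vS: "v \<notin> S" "insert v S \<subseteq> V"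
        using edgeD(3)[of "S \<union> {v, x, y}"] by (auto simp: T_def)
      have "contains_copy H (daisy r (t + 1))"
      proof (rule contains_daisyI)
        show "finite C" "card C = t + 1"
          using C finV finite_subset by auto
        show "finite (insert v S)" "card (insert v S) = r - 2"
          using S vS r by auto
        show "C \<inter> insert v S = {}"
          using disj by auto
        show "C \<union> insert v S \<subseteq> verts H"
          using C vS by (auto simp: V_def)
        show "insert v S \<union> {x, y} \<in> edges H" if "x \<in> C" "y \<in> C" "x \<noteq> y" for x y
          using clique[OF that] by (simp add: T_def insert_commute)
      qed
      then show False
        using free by contradiction
    qed
  qed
  have swap: "T b a c" if "T a b c" for a b c
    using that by (auto simp: T_def insert_commute)
  have ineq: "(n - D) * (n - D - 2 * K)\<^sup>2
      \<le> (t - 1) * (K * n\<^sup>2) + (t - 1)\<^sup>2 * (n * (2 * K * D))"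
    using triple_system_inequality[where T = T, OF link swap T0] unfolding n_def K_def by blast
  define d where "d = real D / real n"
  define k where "k = real K / real n"
  have Dd: "real D = d * real n" and Kk: "real K = k * real n"
    using npos by (auto simp: d_def k_def)
  have d: "0 \<le> d" "d \<le> u + u\<^sup>2 / 36"
    using D npos by (auto simp: d_def pos_divide_le_eq)
  have "real K \<le> u / 36 * real n"
  proof (cases "n \<le> t * D")
    case True
    then have "real K = real t * real D - real n"
      by (simp add: K_def of_nat_diff)
    then show ?thesis
      using tD by (simp add: algebra_simps)
  qed (use u in \<open>simp add: K_def\<close>)
  then have k: "0 \<le> k" "k \<le> u / 36"
    using npos by (auto simp: k_def pos_divide_le_eq)
  \<comment> \<open>This ensures that the truncated differences in \<open>ineq\<close> are true
    differences. The inequality is then homogeneous of degree 3 in \<open>n\<close>, and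
    \<open>n ^ 3\<close> cancels.\<close>
  have "d + 2 * k \<le> 1"
    using d k u u2 by linarith
  then have "(d + 2 * k) * real n \<le> 1 * real n"
    by (rule mult_right_mono) simp
  then have "real D + 2 * real K \<le> real n"
    by (simp add: Dd Kk distrib_right mult.assoc)
  then have "D + 2 * K \<le> n"
    by linarith
  then have "real (n - D) = real n - real D" "real (n - D - 2 * K) = real n - real D - 2 * real K"
    by linarith+
  then have sub: "real (n - D) = (1 - d) * real n" "real (n - D - 2 * K) = (1 - d - 2 * k) * real n"
    unfolding Dd Kk by (simp_all only: left_diff_distrib mult_1 mult.assoc)
  have factor: "(p * x) * (q * x)\<^sup>2 = p * q\<^sup>2 * x ^ 3"
    "s * (k * x * x\<^sup>2) + s\<^sup>2 * (x * (2 * (k * x) * (d * x))) = (s * k + s\<^sup>2 * (2 * k * d)) * x ^ 3"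
    for p q s x :: real
    by (simp_all add: algebra_simps power2_eq_square power3_eq_cube)
  have t1: "real (t - 1) = real t - 1"
    using t by simp
  have "real ((n - D) * (n - D - 2 * K)\<^sup>2)
      \<le> real ((t - 1) * (K * n\<^sup>2) + (t - 1)\<^sup>2 * (n * (2 * K * D)))"
    using ineq by (rule of_nat_mono)
  then have "(1 - d) * (1 - d - 2 * k)\<^sup>2 * real n ^ 3
      \<le> ((real t - 1) * k + (real t - 1)\<^sup>2 * (2 * k * d)) * real n ^ 3"
    unfolding of_nat_mult of_nat_add of_nat_power of_nat_numeral sub Dd Kk t1
      factor(1)[of "1 - d" "real n" "1 - d - 2 * k"] factor(2)[of "real t - 1" "real n"] .
  then have "(1 - d) * (1 - d - 2 * k)\<^sup>2 \<le> (real t - 1) * k + (real t - 1)\<^sup>2 * (2 * k * d)"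
    by (rule mult_right_le_imp_le) (use npos in simp)
  moreover have "(real t - 1) * k + (real t - 1)\<^sup>2 * (2 * k * d) < (1 - d) * (1 - d - 2 * k)\<^sup>2"
  proof (rule triple_system_inequality_fails)
    have "u / 36 = 1 / (36 * real t)" "u\<^sup>2 / 36 = 1 / (36 * (real t)\<^sup>2)"
      by (simp_all add: u_def power_one_over)
    then show "k \<le> 1 / (36 * real t)" "d \<le> 1 / real t + 1 / (36 * (real t)\<^sup>2)"
      using k(2) d(2) unfolding u_def[symmetric] by linarith+
  qed (use t k(1) d(1) in simp_all)
  ultimately show False
    by linarith
qed

section \<open>Blow-ups and convergence of the density\<close>

definition free_graphs :: "nat \<Rightarrow> nat \<Rightarrow> 'b hypergraph \<Rightarrow> nat hypergraph set" where
  "free_graphs r n F =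
     {H. r_graph r H \<and> card (verts H) = n \<and> edges H \<noteq> {} \<and> \<not> contains_copy H F}"

lemma co_ex_pos_eq: "co_ex_pos r n F = Max (pos_codegree r ` free_graphs r n F)"
  by (simp only: co_ex_pos_def free_graphs_def image_Collect)

text \<open>If any two vertices of \<open>F\<close> lie in a common edge, then an \<open>F\<close> in a blow-up meets each
  class at most once and projects to an \<open>F\<close> in the original graph.\<close>

lemma blow_up:
  fixes F :: "'b hypergraph"
  assumes F: "\<And>a b. \<lbrakk>a \<in> verts F; b \<in> verts F\<rbrakk> \<Longrightarrow> \<exists>e\<in>edges F. a \<in> e \<and> b \<in> e"
    and H: "H \<in> free_graphs r n F" and r: "r \<ge> 1" and nN: "n \<le> N"
  shows "\<exists>H'\<in>free_graphs r N F. (N div n) * pos_codegree r H \<le> pos_codegree r H'"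
proof -
  define V where "V = verts H"
  define m where "m = N div n"
  have rH: "r_graph r H" and cardV: "card V = n" and ne: "edges H \<noteq> {}"
    and free: "\<not> contains_copy H F"
    using H by (auto simp: free_graphs_def V_def)
  have finV: "finite V"
    using rH by (simp add: r_graph_def V_def)
  have edgeD: "finite e" "card e = r" "e \<subseteq> V" if "e \<in> edges H" for e
    using rH that by (auto simp: r_graph_def nsets_def V_def)
  obtain h where h: "bij_betw h {..<n} V"
    using finite_same_card_bij[of "{..<n}" V] finV cardV by auto
  obtain e0 where e0: "e0 \<in> edges H"
    using ne by auto
  have n: "n > 0"
    using edgeD[OF e0] r finV cardV by (auto simp: card_gt_0_iff)
  \<comment> \<open>The classes of the blow-up are the residue classes modulo \<open>n\<close> in
    \<open>{..<N}\<close>. Each has at least \<open>m\<close> members, also when \<open>n\<close>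
    does not divide \<open>N\<close>.\<close>
  define \<phi> where "\<phi> = (\<lambda>i. h (i mod n))"
  define E where "E = {e. e \<subseteq> {..<N} \<and> card e = r \<and> \<phi> ` e \<in> edges H}"
  define H' where "H' = ({..<N}, E)"
  have \<phi>V: "\<phi> i \<in> V" for i
    using bij_betw_apply[OF h, of "i mod n"] n by (simp add: \<phi>_def)
  have inj: "inj_on \<phi> e" if "e \<in> E" for e
  proof (rule eq_card_imp_inj_on)
    show "finite e"
      using that finite_subset[of e "{..<N}"] by (simp add: E_def)
    show "card (\<phi> ` e) = card e"
      using that edgeD(2)[of "\<phi> ` e"] by (simp add: E_def)
  qed
  have "e \<in> nsets {..<N} r" if "e \<in> E" for e
    using that finite_subset[of e "{..<N}"] by (simp add: E_def nsets_def)
  then have rH': "r_graph r H'"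
    by (simp add: r_graph_def H'_def subsetI)
  \<comment> \<open>A copy of \<open>e0\<close> among the first \<open>n\<close> vertices shows that
    the blow-up has an edge.\<close>
  define e1 where "e1 = {i \<in> {..<n}. h i \<in> e0}"
  have e1: "h ` e1 = e0"
    using bij_betw_imp_surj_on[OF h] edgeD(3)[OF e0] unfolding e1_def by blast
  have "e1 \<in> E"
  proof -
    have "inj_on h e1"
      by (rule inj_on_subset[OF bij_betw_imp_inj_on[OF h]]) (auto simp: e1_def)
    then have "card e1 = r"
      using card_image[of h e1] e1 edgeD(2)[OF e0] by simp
    moreover have "\<phi> ` e1 = h ` e1"
      by (rule image_cong) (auto simp: \<phi>_def e1_def)
    ultimately show ?thesis
      using nN e0 e1 by (auto simp: E_def e1_def)
  qed
  then have ne': "edges H' \<noteq> {}"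
    by (auto simp: H'_def)
  have free': "\<not> contains_copy H' F"
  proof
    assume "contains_copy H' F"
    then obtain f where f: "inj_on f (verts F)" "\<forall>e\<in>edges F. f ` e \<in> edges H'"
      unfolding contains_copy_def by blast
    have fE: "f ` e \<in> E" if "e \<in> edges F" for e
      using f(2) that by (simp add: H'_def)
    have "contains_copy H F"
      unfolding contains_copy_def
    proof (intro exI[of _ "\<phi> \<circ> f"] conjI ballI)
      show "inj_on (\<phi> \<circ> f) (verts F)"
      proof (rule inj_onI)
        fix a b assume ab: "a \<in> verts F" "b \<in> verts F" "(\<phi> \<circ> f) a = (\<phi> \<circ> f) b"
        then obtain e where e: "e \<in> edges F" "a \<in> e" "b \<in> e"
          using F by blast
        have "f a = f b"
          using inj_onD[OF inj[OF fE[OF e(1)]], of "f a" "f b"] ab(3) e(2,3) by simp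
        then show "a = b"
          by (rule inj_onD[OF f(1)]) fact+
      qed
      show "(\<phi> \<circ> f) ` verts F \<subseteq> verts H"
        using \<phi>V by (auto simp: V_def)
      show "(\<phi> \<circ> f) ` e \<in> edges H" if "e \<in> edges F" for e
        using fE[OF that] by (simp add: E_def image_comp)
    qed
    then show False
      using free by contradiction
  qed
  define fibre where "fibre = (\<lambda>u. {i \<in> {..<N}. \<phi> i = u})"
  have fibre: "m \<le> card (fibre u)" if u: "u \<in> V" for u
  proof -
    obtain k where k: "k < n" "h k = u"
      using u h by (auto simp: bij_betw_def)
    have "inj_on (\<lambda>j. k + j * n) {..<m}"
      using n by (auto simp: inj_on_def)
    then have "m = card ((\<lambda>j. k + j * n) ` {..<m})"
      by (simp add: card_image)
    also have "\<dots> \<le> card (fibre u)"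
    proof (intro card_mono image_subsetI)
      fix j assume "j \<in> {..<m}"
      then have "(j + 1) * n \<le> m * n"
        by (intro mult_right_mono) auto
      also have "m * n \<le> N"
        by (simp add: m_def)
      finally show "k + j * n \<in> fibre u"
        using k by (auto simp: fibre_def \<phi>_def)
    qed (simp add: fibre_def)
    finally show ?thesis .
  qed
  \<comment> \<open>A set of minimum positive degree in the blow-up projects injectively to one of
    positive degree in \<open>H\<close>, and each vertex extending the projection lifts to its whole
    fibre.\<close>
  obtain S where S: "S \<in> nsets (verts H') (r - 1)" "set_degree H' S > 0"
    "set_degree H' S = pos_codegree r H'"
    using pos_codegree_attained[OF rH' r ne'] by blast
  obtain e where e: "e \<in> E" "S \<subseteq> e"
    using S(2) set_degree_pos_iff[OF rH'] by (auto simp: H'_def)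
  have S': "S \<subseteq> {..<N}" "finite S" "card S = r - 1"
    using S(1) by (auto simp: nsets_def H'_def)
  have \<phi>S: "\<phi> ` S \<in> nsets (verts H) (r - 1)"
    using S' \<phi>V card_image[OF inj_on_subset[OF inj[OF e(1)] e(2)]] by (auto simp: nsets_def V_def)
  have "set_degree H (\<phi> ` S) > 0"
    using e set_degree_pos_iff[OF rH] by (auto simp: E_def)
  then have "pos_codegree r H \<le> set_degree H (\<phi> ` S)"
    by (rule pos_codegree_le_set_degree[OF rH \<phi>S])
  also define A where "A = {u \<in> V - \<phi> ` S. insert u (\<phi> ` S) \<in> edges H}"
  have "set_degree H (\<phi> ` S) = card A"
    using set_degree_eq_card_extensions[OF rH \<phi>S r] by (simp add: A_def V_def)
  finally have "m * pos_codegree r H \<le> card A * m"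
    by simp
  also have "\<dots> \<le> (\<Sum>u\<in>A. card (fibre u))"
    using fibre by (intro sum_bounded_below[where 'a=nat, simplified]) (auto simp: A_def)
  also have "\<dots> = card (\<Union>u\<in>A. fibre u)"
    using finV by (intro card_UN_disjoint[symmetric]) (auto simp: A_def fibre_def)
  also have "\<dots> \<le> card {y \<in> {..<N} - S. insert y S \<in> E}"
  proof (intro card_mono subsetI)
    fix y assume "y \<in> (\<Union>u\<in>A. fibre u)"
    then have y: "y < N" "\<phi> y \<notin> \<phi> ` S" "insert (\<phi> y) (\<phi> ` S) \<in> edges H"
      by (auto simp: A_def fibre_def)
    then have "y \<notin> S"
      by auto
    then show "y \<in> {y \<in> {..<N} - S. insert y S \<in> E}"
      using y S' r by (auto simp: E_def)
  qed auto
  also have "\<dots> = pos_codegree r H'"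
    using set_degree_eq_card_extensions[OF rH' S(1) r] S(3) by (simp add: H'_def)
  finally have "m * pos_codegree r H \<le> pos_codegree r H'" .
  moreover have "H' \<in> free_graphs r N F"
    using rH' ne' free' by (simp add: free_graphs_def H'_def)
  ultimately show ?thesis
    unfolding m_def by blast
qed

lemma daisy_edgeI:
  assumes "e \<in> nsets {..<t} 2"
  shows "e \<union> {t..<t + (r - 2)} \<in> edges (daisy r t)"
  unfolding daisy_def snd_conv by (rule CollectI) (intro exI[of _ e] conjI refl assms)

lemma daisy_covers_pairs:
  assumes "t \<ge> 2" "a \<in> verts (daisy r t)" "b \<in> verts (daisy r t)"
  shows "\<exists>e\<in>edges (daisy r t). a \<in> e \<and> b \<in> e"
proof -
  \<comment> \<open>The added vertices lie in every edge, so \<open>x\<close> and \<open>y\<close>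
    only have to catch those of \<open>a\<close>, \<open>b\<close> below \<open>t\<close>; the
    defaults 0 and 1 keep them distinct.\<close>
  define x where "x = (if a < t then a else if b < t then b else 0)"
  define y where "y = (if b < t \<and> b \<noteq> x then b else if x = 0 then 1 else 0)"
  have "x < t" "y < t" "x \<noteq> y"
    using assms(1) by (simp_all add: x_def y_def)
  then have "{x, y} \<in> nsets {..<t} 2"
    by (simp add: nsets_def)
  then have "{x, y} \<union> {t..<t + (r - 2)} \<in> edges (daisy r t)"
    by (rule daisy_edgeI)
  moreover have "a < t \<Longrightarrow> a = x" "b < t \<Longrightarrow> b = x \<or> b = y"
    by (simp_all add: x_def y_def)
  then have "a \<in> {x, y} \<union> {t..<t + (r - 2)} \<and> b \<in> {x, y} \<union> {t..<t + (r - 2)}"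
    using assms(2,3) unfolding daisy_def fst_conv Un_iff lessThan_iff atLeastLessThan_iff insert_iff
    by linarith
  ultimately show ?thesis
    by (rule bexI[rotated])
qed

text \<open>From \<open>t >= 3\<close> on, the daisy has two distinct edges, which an injective map
  cannot send to the same edge; so a graph with a single edge is free of it.\<close>

lemma free_graphs_daisy_nonempty:
  assumes "t \<ge> 3" "r \<ge> 1" "r \<le> n"
  shows "free_graphs r n (daisy r t) \<noteq> {}"
proof -
  let ?H = "({..<n}, {{..<r}}) :: nat hypergraph"
  let ?I = "{t..<t + (r - 2)}"
  have "\<not> contains_copy ?H (daisy r t)"
  proof
    assume "contains_copy ?H (daisy r t)"
    then obtain f where f: "inj_on f (verts (daisy r t))"
      "\<forall>e\<in>edges (daisy r t). f ` e \<in> edges ?H"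
      unfolding contains_copy_def by blast
    have nsets: "{0, 1} \<in> nsets {..<t} 2" "{0, 2} \<in> nsets {..<t} 2"
      using assms by (auto simp: nsets_def)
    have e: "{0, 1} \<union> ?I \<in> edges (daisy r t)" "{0, 2} \<union> ?I \<in> edges (daisy r t)"
      by (intro daisy_edgeI nsets)+
    have "f ` ({0, 1} \<union> ?I) = f ` ({0, 2} \<union> ?I)"
      using bspec[OF f(2) e(1)] bspec[OF f(2) e(2)] by simp
    then have "{0, 1} \<union> ?I = {0, 2} \<union> ?I"
      by (subst (asm) inj_on_image_eq_iff[OF f(1)]) (use assms in \<open>auto simp: daisy_def\<close>)
    from equalityD1[OF this] have "1 \<in> {0, 2} \<union> ?I"
      by (rule subsetD) simp
    then show False
      using assms by simp
  qed
  then have "?H \<in> free_graphs r n (daisy r t)"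
    using assms by (auto simp: free_graphs_def r_graph_def nsets_def)
  then show ?thesis
    by blast
qed

text \<open>The hypothesis on \<open>N div n\<close> gives \<open>a N / N \<ge> a n / n - a n / N\<close>, so the
  densities converge to their supremum.\<close>

lemma lim_density_le:
  fixes a :: "nat \<Rightarrow> nat" and c :: real
  assumes r: "r \<ge> 1" and bound: "\<And>n. n \<ge> r \<Longrightarrow> real (a n) \<le> c * real n"
    and blow: "\<And>n N. \<lbrakk>r \<le> n; n \<le> N\<rbrakk> \<Longrightarrow> (N div n) * a n \<le> a N"
  shows "lim (\<lambda>n. real (a n) / real n) \<le> c"
proof -
  define X where "X = (\<lambda>n. real (a n) / real n) ` {r..}"
  have le: "x \<le> c" if "x \<in> X" for x
    using that bound r by (auto simp: X_def pos_divide_le_eq)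
  have ne: "X \<noteq> {}"
    by (auto simp: X_def)
  have bdd: "bdd_above X"
    using le by (rule bdd_aboveI)
  have "(\<lambda>n. real (a n) / real n) \<longlonglongrightarrow> Sup X"
  proof (rule order_tendstoI)
    fix y assume "y < Sup X"
    then obtain n where n: "n \<ge> r" "y < real (a n) / real n"
      using less_cSup_iff[OF ne bdd] by (auto simp: X_def)
    have ge: "real (a n) / real n - real (a n) / real N \<le> real (a N) / real N" if N: "n \<le> N" for N
    proof -
      have pos: "real n > 0" "real N > 0"
        using n r N by auto
      have "N < (N div n + 1) * n"
        using pos by (simp add: dividend_less_div_times)
      then have "real N < (real (N div n) + 1) * real n"
        by (metis of_nat_1 of_nat_add of_nat_less_iff of_nat_mult)
      then have "real N / real n - 1 \<le> real (N div n)"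
        using pos by (simp add: field_simps)
      then have "(real N / real n - 1) * real (a n) \<le> real (N div n) * real (a n)"
        by (rule mult_right_mono) simp
      also have "\<dots> \<le> real (a N)"
        using blow[OF n(1) N] by (metis of_nat_le_iff of_nat_mult)
      finally have "(real N / real n - 1) * real (a n) / real N \<le> real (a N) / real N"
        by (rule divide_right_mono) simp
      also have "(real N / real n - 1) * real (a n) / real N
          = real (a n) / real n - real (a n) / real N"
        using pos by (simp add: field_simps)
      finally show ?thesis .
    qed
    have "(\<lambda>N. real (a n) / real n - real (a n) / real N) \<longlonglongrightarrow> real (a n) / real n - 0"
      by (intro tendsto_intros lim_const_over_n)
    then have "\<forall>\<^sub>F N in sequentially. y < real (a n) / real n - real (a n) / real N"
      using n(2) by (intro order_tendstoD(1)) auto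
    then show "\<forall>\<^sub>F N in sequentially. y < real (a N) / real N"
      using eventually_ge_at_top[of n] by eventually_elim (use ge in fastforce)
  next
    fix y assume y: "Sup X < y"
    show "\<forall>\<^sub>F N in sequentially. real (a N) / real N < y"
    proof (rule eventually_sequentiallyI[of r])
      fix N assume "r \<le> N"
      then have "real (a N) / real N \<in> X"
        by (simp add: X_def)
      then have "real (a N) / real N \<le> Sup X"
        using bdd by (rule cSup_upper)
      then show "real (a N) / real N < y"
        using y by (rule le_less_trans)
    qed
  qed
  then have "lim (\<lambda>n. real (a n) / real n) = Sup X"
    by (rule limI)
  also have "\<dots> \<le> c"
    using ne le by (rule cSup_least)
  finally show ?thesis .
qed

theorem theorem1p5:
  fixes r t :: nat
  assumes "r \<ge> 3" and "t \<ge> 2"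
  shows "pos_codegree_density r (daisy r (t + 1)) \<le> 1 - 1 / real t - 1 / (36 * (real t)\<^sup>2)"
proof -
  let ?F = "daisy r (t + 1)"
  let ?c = "1 - 1 / real t - 1 / (36 * (real t)\<^sup>2)"
  have bound: "real (pos_codegree r H) \<le> ?c * real n" if "H \<in> free_graphs r n ?F" for n H
    using that pos_codegree_daisy_free_le[OF assms, of H] by (auto simp: free_graphs_def)
  \<comment> \<open>There are infinitely many graphs, as any \<open>n\<close> natural numbers may
    serve as vertices. \<open>Max\<close> is meaningful because their codegrees are at most
    \<open>n\<close>.\<close>
  have fin: "finite (pos_codegree r ` free_graphs r n ?F)" for n
  proof (rule finite_subset)
    show "pos_codegree r ` free_graphs r n ?F \<subseteq> {..n}"
    proof (rule image_subsetI)
      fix H assume "H \<in> free_graphs r n ?F"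
      then have "real (pos_codegree r H) \<le> ?c * real n"
        by (rule bound)
      also have "\<dots> \<le> 1 * real n"
      proof (rule mult_right_mono)
        have "0 \<le> 1 / real t" "0 \<le> 1 / (36 * (real t)\<^sup>2)"
          by simp_all
        then show "?c \<le> 1"
          by linarith
      qed simp
      finally show "pos_codegree r H \<in> {..n}"
        by simp
    qed
  qed simp
  have attained: "\<exists>H\<in>free_graphs r n ?F. pos_codegree r H = co_ex_pos r n ?F" if "n \<ge> r" for n
    using Max_in[OF fin, of n] free_graphs_daisy_nonempty[of "t + 1" r n] assms that
    unfolding co_ex_pos_eq[symmetric] by force
  show ?thesis
    unfolding pos_codegree_density_def
  proof (rule lim_density_le)
    show "r \<ge> 1"
      using assms by simp
    show "real (co_ex_pos r n ?F) \<le> ?c * real n" if "n \<ge> r" for n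
      using attained[OF that] bound by metis
    show "(N div n) * co_ex_pos r n ?F \<le> co_ex_pos r N ?F" if n: "r \<le> n" "n \<le> N" for n N
    proof -
      obtain H where H: "H \<in> free_graphs r n ?F" "pos_codegree r H = co_ex_pos r n ?F"
        using attained[OF n(1)] by blast
      obtain H' where H': "H' \<in> free_graphs r N ?F"
        "(N div n) * pos_codegree r H \<le> pos_codegree r H'"
        using blow_up[OF daisy_covers_pairs H(1) _ n(2)] assms by auto
      have "pos_codegree r H' \<le> co_ex_pos r N ?F"
        unfolding co_ex_pos_eq using H'(1) by (intro Max_ge fin imageI)
      then show ?thesis
        using H H' by simp
    qed
  qed
qed

end
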